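(* Let $\alpha$ be a countable ordinal number and let $F$ be a compact subset of $\mathbb{R}$. Then there exists a compact set $\mathcal{F}\subset\mathbb{R}$ such that $\mathcal{F}^{(\alpha)}=F$.
   Context: For a subset $A$ of a topological space, $A'$ denotes its derived set, i.e. the set of all limit points of $A$ ($x$ is a limit point of $A$ if every neighborhood of $x$ contains a point of $A$ different from $x$). For an ordinal $\alpha$, the $\alpha$-th (Cantor-Bendixson) derivative $A^{(\alpha)}$ is defined by transfinite recursion: $A^{(0)}=A$; $A^{(\beta+1)}=(A^{(\beta)})'$ for every ordinal $\beta$; $A^{(\lambda)}=\bigcap_{\gamma<\lambda}A^{(\gamma)}$ for every limit ordinal $\lambda\neq 0$. Here derivatives are taken in $\mathbb{R}$. A countable ordinal is one that is finite or countably infinite as a set. *)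

theory Defs
  imports "HOL-Analysis.Analysis"
begin

text \<open>
  As in the well-order theories of HOL, an ordinal is represented by a well-order
  \<^term>\<open>r\<close> (\<^term>\<open>Well_order r\<close>), standing for the order type of \<^term>\<open>Field r\<close>, with
  \<^const>\<open>ordIso\<close> and \<^const>\<open>ordLess\<close> as equality and strict order of ordinals.
\<close>

definition init_seg :: "'b rel \<Rightarrow> 'b \<Rightarrow> 'b rel" where
  "init_seg r x = Restr r (underS r x)"

definition is_max :: "'b rel \<Rightarrow> 'b \<Rightarrow> bool" where
  "is_max r m \<longleftrightarrow> m \<in> Field r \<and> (\<forall>x\<in>Field r. (x, m) \<in> r)"

definition derived_set :: "'a::topological_space set \<Rightarrow> 'a set" where
  "derived_set A = {x. x islimpt A}"

lemma the_is_max: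
  assumes "Well_order r" "is_max r m"
  shows "(THE m. is_max r m) = m"
proof (rule the_equality)
  fix n assume "is_max r n"
  then show "n = m"
    using assms
    by (auto simp: is_max_def well_order_on_def linear_order_on_def partial_order_on_def
        dest: antisymD)
qed (fact assms(2))

lemma init_seg_ordLess:
  assumes "Well_order r" "x \<in> Field r"
  shows "(init_seg r x, r) \<in> ordLess"
  unfolding init_seg_def using assms by (intro underS_Restr_ordLess) auto

text \<open>
  The ordinals strictly below \<^term>\<open>r\<close> are, up to isomorphism, the initial segments
  \<^term>\<open>init_seg r x\<close> with \<^term>\<open>x \<in> Field r\<close>.  Hence: \<^term>\<open>r\<close> is zero if its field is empty; it is the successor of
  \<^term>\<open>init_seg r m\<close> if it has a greatest element \<^term>\<open>m\<close>; otherwise it is a limit.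
  The value is \<^const>\<open>undefined\<close> if \<^term>\<open>r\<close> is not a well-order.
\<close>

function cb_derivative :: "'a rel \<Rightarrow> 'b::topological_space set \<Rightarrow> 'b set" where
  "cb_derivative r A =
    (if \<not> Well_order r then undefined
     else if Field r = {} then A
     else if \<exists>m. is_max r m
       then derived_set (cb_derivative (init_seg r (THE m. is_max r m)) A)
     else (\<Inter>x\<in>Field r. cb_derivative (init_seg r x) A))"
  by pat_completeness auto
termination
proof (relation "inv_image ordLess fst")
  show "wf (inv_image ordLess (fst :: 'a rel \<times> 'b set \<Rightarrow> 'a rel))"
    by (intro wf_inv_image wf_ordLess)
next
  fix r :: "'a rel" and A :: "'b set"
  assume r: "\<not> \<not> Well_order r" and "\<exists>m. is_max r m"
  then obtain m where m: "is_max r m" by blast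
  then have "m \<in> Field r" by (simp add: is_max_def)
  then show "((init_seg r (THE m. is_max r m), A), r, A) \<in> inv_image ordLess fst"
    using r m the_is_max[of r m] init_seg_ordLess[of r m] by simp
next
  fix r :: "'a rel" and A :: "'b set" and x
  assume "\<not> \<not> Well_order r" "x \<in> Field r"
  then show "((init_seg r x, A), r, A) \<in> inv_image ordLess fst"
    using init_seg_ordLess[of r x] by simp
qed

declare cb_derivative.simps [simp del]

lemma cb_derivative_zero:
  assumes "Well_order r" "Field r = {}"
  shows "cb_derivative r A = A"
  using assms by (simp add: cb_derivative.simps[of r])

lemma cb_derivative_successor:
  assumes "Well_order r" "is_max r m"
  shows "cb_derivative r A = derived_set (cb_derivative (init_seg r m) A)"
proof -
  have "Field r \<noteq> {}" using assms(2) by (auto simp: is_max_def)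
  then show ?thesis
    using assms the_is_max[OF assms] by (subst cb_derivative.simps) auto
qed

lemma cb_derivative_limit:
  assumes "Well_order r" "Field r \<noteq> {}" "\<nexists>m. is_max r m"
  shows "cb_derivative r A = (\<Inter>x\<in>Field r. cb_derivative (init_seg r x) A)"
  using assms by (subst cb_derivative.simps) auto

lemma Well_order_init_seg: "Well_order r \<Longrightarrow> Well_order (init_seg r x)"
  by (simp add: init_seg_def Well_order_Restr)

lemma Field_init_seg:
  assumes "Well_order r"
  shows "Field (init_seg r x) = underS r x"
proof -
  have "Refl r" using assms
    by (simp add: well_order_on_def linear_order_on_def partial_order_on_def preorder_on_def)
  then show ?thesis
    unfolding init_seg_def by (rule Refl_Field_Restr2) (auto simp: underS_def Field_def)
qed

lemma iso_is_max:
  assumes f: "iso r s f" and m: "is_max r m"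
  shows "is_max s (f m)"
  unfolding is_max_def
proof (intro conjI ballI)
  show "f m \<in> Field s" using m iso_Field[OF f] by (auto simp: is_max_def)
  fix y assume "y \<in> Field s"
  then obtain x where "x \<in> Field r" "y = f x" using iso_Field[OF f] by blast
  then show "(y, f m) \<in> s" using m f by (auto simp: is_max_def iso_iff2)
qed

lemma iso_init_seg:
  assumes f: "iso r s f" and r: "Well_order r" and s: "Well_order s" and x: "x \<in> Field r"
  shows "(init_seg r x, init_seg s (f x)) \<in> ordIso"
proof -
  have bij: "bij_betw f (Field r) (Field s)"
    and ord: "\<And>a b. a \<in> Field r \<Longrightarrow> b \<in> Field r \<Longrightarrow> (a, b) \<in> r \<longleftrightarrow> (f a, f b) \<in> s"
    using f by (auto simp: iso_iff2)
  have inj: "inj_on f (Field r)" and img: "f ` Field r = Field s"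
    using bij by (auto simp: bij_betw_def)
  have uF: "underS r x \<subseteq> Field r" "underS s (f x) \<subseteq> Field s"
    by (auto simp: underS_Field)
  have im: "f ` underS r x = underS s (f x)"
  proof (intro set_eqI iffI)
    fix y assume "y \<in> f ` underS r x"
    then show "y \<in> underS s (f x)"
      using uF x ord inj by (auto simp: underS_def inj_on_def) 
  next
    fix y assume y: "y \<in> underS s (f x)"
    then obtain a where a: "a \<in> Field r" "y = f a" using uF img by blast
    then have "a \<in> underS r x" using y x ord by (auto simp: underS_def)
    then show "y \<in> f ` underS r x" using a by blast
  qed
  have "iso (init_seg r x) (init_seg s (f x)) f"
    unfolding iso_iff2 Field_init_seg[OF r] Field_init_seg[OF s]
  proof (intro conjI ballI)
    show "bij_betw f (underS r x) (underS s (f x))"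
      using im inj uF by (auto simp: bij_betw_def inj_on_def)
  next
    fix a b assume "a \<in> underS r x" "b \<in> underS r x"
    then show "((a, b) \<in> init_seg r x) = ((f a, f b) \<in> init_seg s (f x))"
      using ord uF im by (auto simp: init_seg_def)
  qed
  then show ?thesis
    using r s by (auto simp: ordIso_def Well_order_init_seg)
qed

text \<open>The derivative depends only on the order type, so it is well defined on ordinals.\<close>

theorem cb_derivative_ordIso:
  fixes r :: "'b rel" and s :: "'c rel" and A :: "'a::topological_space set"
  assumes "(r, s) \<in> ordIso"
  shows "cb_derivative r A = cb_derivative s A"
  using assms
proof (induction r arbitrary: s rule: wf_induct_rule[OF wf_ordLess])
  case (1 r)
  obtain f where r: "Well_order r" and s: "Well_order s" and f: "iso r s f"
    using 1(2) by (auto simp: ordIso_def)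
  have img: "f ` Field r = Field s" using f by (rule iso_Field)
  have seg: "cb_derivative (init_seg r x) A = cb_derivative (init_seg s (f x)) A"
    if "x \<in> Field r" for x
    using 1(1) init_seg_ordLess[OF r that] iso_init_seg[OF f r s that] by blast
  consider "Field r = {}" | m where "is_max r m" | "Field r \<noteq> {}" "\<nexists>m. is_max r m" by blast
  then show ?case
  proof cases
    case 1
    then show ?thesis using r s img by (simp add: cb_derivative_zero)
  next
    case 2
    then have "m \<in> Field r" by (simp add: is_max_def)
    then show ?thesis
      using cb_derivative_successor[OF r 2, of A] cb_derivative_successor[OF s iso_is_max[OF f 2], of A] seg[of m]
      by simp
  next
    case 3
    have "\<nexists>m. is_max s m"
    proof
      assume "\<exists>m. is_max s m"
      then obtain n where n: "is_max s n" by blast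
      then obtain a where "a \<in> Field r" "n = f a" using img by (auto simp: is_max_def)
      then have "is_max r a" using n f by (auto simp: is_max_def iso_iff2 bij_betw_def)
      then show False using 3 by blast
    qed
    moreover have "Field s \<noteq> {}" using 3 img by blast
    moreover have "(\<Inter>x\<in>Field r. cb_derivative (init_seg r x) A)
                 = (\<Inter>y\<in>Field s. cb_derivative (init_seg s y) A)"
      unfolding img[symmetric] image_image by (rule INF_cong[OF refl]) (rule seg)
    ultimately show ?thesis using cb_derivative_limit[OF r, of A] cb_derivative_limit[OF s, of A] 3 by metis
  qed
qed

end

theory Submission
  imports Defs
begin

text \<open>
  Argue by induction on \<open>\<alpha>\<close>. Along the frontier of \<open>F\<close> place pairwise disjoint compact sets
  \<open>K n\<close> outside \<open>F\<close> whose distance from \<open>F\<close> tends to \<open>0\<close>, such that every frontier point is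
  approached by infinitely many of them, and such that the \<open>g n\<close>-th derivative of \<open>K n\<close> is a
  singleton. Here \<open>g n < \<alpha>\<close> are ordinals which eventually exceed each ordinal below \<open>\<alpha>\<close>. Then
  \<open>F \<union> (\<Union>n. K n)\<close> is compact. Since derivatives are local, its \<open>\<alpha>\<close>-th derivative avoids
  each \<open>K n\<close>; and since each earlier derivative meets almost all \<open>K n\<close>, every derivative up to
  the \<open>\<alpha>\<close>-th contains \<open>F\<close>.
\<close>

section \<open>Well-orders and their initial segments\<close>

lemma Well_order_le_total:
  assumes "Well_order r" "x \<in> Field r" "y \<in> Field r"
  shows "(x, y) \<in> r \<or> y \<in> underS r x"
  using assms wo_rel.TOTALS[of r] wo_rel.REFL[of r]
  by (auto simp: wo_rel_def underS_def refl_on_def)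

lemma underS_mono_Well_order:
  assumes "Well_order r" "(x, y) \<in> r"
  shows "underS r x \<subseteq> underS r y"
  using assms wo_rel.TRANS[of r] wo_rel.ANTISYM[of r]
  by (auto simp: wo_rel_def underS_def dest: transD antisymD)

text \<open>Lets derivatives along a segment of \<open>r\<close> be expressed through segments of
  \<open>r\<close> itself.\<close>

lemma init_seg_init_seg:
  assumes "Well_order r" "y \<in> underS r x"
  shows "init_seg (init_seg r x) y = init_seg r y"
proof -
  have "underS r y \<subseteq> underS r x"
    using assms underS_mono_Well_order by (fastforce simp: underS_def)
  moreover have "underS (init_seg r x) y = underS r y \<inter> underS r x"
    using assms by (auto simp: init_seg_def underS_def)
  ultimately show ?thesis by (auto simp: init_seg_def)
qed

section \<open>Derivatives of closed sets\<close>

text \<open>A closed set contains its limit points, so the derivatives decrease and the clauses for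
  zero, successor and limit merge into one formula. Later inductions then need no case split on the
  kind of ordinal.\<close>

lemma cb_derivative_closed_eq:
  fixes A :: "'a::topological_space set"
  assumes "Well_order r" "closed A"
  shows "cb_derivative r A = A \<inter> (\<Inter>x\<in>Field r. derived_set (cb_derivative (init_seg r x) A))"
  using assms(1)
proof (induction r rule: wf_induct_rule[OF wf_ordLess])
  case (1 r)
  note r = 1(2)
  define D where "D x = cb_derivative (init_seg r x) A" for x
  have D_eq: "D x = A \<inter> (\<Inter>y\<in>underS r x. derived_set (D y))" if "x \<in> Field r" for x
    using 1(1)[OF init_seg_ordLess[OF r that] Well_order_init_seg[OF r]]
    by (simp add: D_def Field_init_seg[OF r] init_seg_init_seg[OF r])
  have D_anti: "D y \<subseteq> D x" if "(x, y) \<in> r" for x y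
    using underS_mono_Well_order[OF r that] FieldI1[OF that] FieldI2[OF that]
    by (auto simp: D_eq)
  consider "Field r = {}" | m where "is_max r m" | "Field r \<noteq> {}" "\<nexists>m. is_max r m" by blast
  then have "cb_derivative r A = A \<inter> (\<Inter>x\<in>Field r. derived_set (D x))"
  proof cases
    case 1
    then show ?thesis using r by (simp add: cb_derivative_zero)
  next
    case 2
    then have m: "m \<in> Field r" "\<And>x. x \<in> Field r \<Longrightarrow> (x, m) \<in> r"
      by (auto simp: is_max_def)
    \<comment> \<open>At a maximum \<open>m\<close>, \<open>derived_set (D m)\<close> is the least
      set of the family, hence its intersection.\<close>
    have "derived_set (D m) \<subseteq> derived_set (D x)" if "x \<in> Field r" for x
      using D_anti[OF m(2)[OF that]] by (auto simp: derived_set_def intro: islimpt_subset)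
    moreover have "derived_set (D m) \<subseteq> A"
      using D_eq[OF m(1)] assms(2)
      by (auto simp: derived_set_def closed_limpt dest: islimpt_subset[where T=A])
    moreover have "cb_derivative r A = derived_set (D m)"
      unfolding D_def by (rule cb_derivative_successor[OF r 2])
    ultimately show ?thesis using m(1) by auto
  next
    case 3
    \<comment> \<open>Without a maximum every \<open>y\<close> lies strictly below some
      \<open>x\<close>, so the double intersection below reaches every \<open>y\<close> in
      \<open>Field r\<close>.\<close>
    have succ: "\<exists>x\<in>Field r. y \<in> underS r x" if "y \<in> Field r" for y
      using 3(2) that Well_order_le_total[OF r _ that] unfolding is_max_def by blast
    have "cb_derivative r A = (\<Inter>x\<in>Field r. D x)"
      unfolding D_def by (rule cb_derivative_limit[OF r 3])
    also have "\<dots> = (\<Inter>x\<in>Field r. A \<inter> (\<Inter>y\<in>underS r x. derived_set (D y)))"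
      using D_eq by (intro INF_cong) auto
    also have "\<dots> = A \<inter> (\<Inter>x\<in>Field r. derived_set (D x))"
    proof (intro set_eqI iffI)
      fix z assume z: "z \<in> (\<Inter>x\<in>Field r. A \<inter> (\<Inter>y\<in>underS r x. derived_set (D y)))"
      then show "z \<in> A \<inter> (\<Inter>x\<in>Field r. derived_set (D x))"
        using succ 3(1) by blast
    next
      fix z assume z: "z \<in> A \<inter> (\<Inter>x\<in>Field r. derived_set (D x))"
      then show "z \<in> (\<Inter>x\<in>Field r. A \<inter> (\<Inter>y\<in>underS r x. derived_set (D y)))"
        using underS_Field[of _ r] by blast
    qed
    finally show ?thesis .
  qed
  then show ?case by (simp add: D_def)
qed

lemma cb_derivative_subset:
  assumes "Well_order r" "closed A"
  shows "cb_derivative r A \<subseteq> A"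
  using cb_derivative_closed_eq[OF assms] by auto

lemma cb_derivative_init_seg_antimono:
  assumes r: "Well_order r" and A: "closed A" and xy: "(x, y) \<in> r"
  shows "cb_derivative (init_seg r y) A \<subseteq> cb_derivative (init_seg r x) A"
  using underS_mono_Well_order[OF r xy]
  by (auto simp: cb_derivative_closed_eq[OF Well_order_init_seg[OF r] A]
      Field_init_seg[OF r] init_seg_init_seg[OF r])

text \<open>Whether \<open>z\<close> is a limit point of a set depends only on the set near
  \<open>z\<close>; the closed-set formula carries this through the induction. Taking
  \<open>U\<close> to be the whole space gives monotonicity.\<close>

lemma cb_derivative_local:
  fixes A B :: "'a::topological_space set"
  assumes "Well_order r" and A: "closed A" and B: "closed B" and U: "open U" "A \<inter> U \<subseteq> B"
  shows "cb_derivative r A \<inter> U \<subseteq> cb_derivative r B"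
  using assms(1)
proof (induction r rule: wf_induct_rule[OF wf_ordLess])
  case (1 r)
  note r = 1(2)
  show ?case
  proof
    fix z assume z: "z \<in> cb_derivative r A \<inter> U"
    have "z \<in> derived_set (cb_derivative (init_seg r x) B)" if x: "x \<in> Field r" for x
    proof -
      have "z islimpt cb_derivative (init_seg r x) A"
        using z x by (auto simp: cb_derivative_closed_eq[OF r A] derived_set_def)
      then have "z islimpt cb_derivative (init_seg r x) A \<inter> U"
        using z U(1) by (auto simp: islimpt_Int_eventually eventually_at_in_open')
      then show ?thesis
        using 1(1)[OF init_seg_ordLess[OF r x] Well_order_init_seg[OF r]]
        by (auto simp: derived_set_def intro: islimpt_subset)
    qed
    moreover have "z \<in> B"
      using z cb_derivative_subset[OF r A] U(2) by blast
    ultimately show "z \<in> cb_derivative r B"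
      by (simp add: cb_derivative_closed_eq[OF r B])
  qed
qed

lemmas cb_derivative_mono =
  cb_derivative_local[where U=UNIV, OF _ _ _ open_UNIV, unfolded Int_UNIV_right]

text \<open>Cut \<open>K\<close> down to a small closed ball about \<open>p\<close>: monotonicity
  allows no point but \<open>p\<close>, and locality on the open ball keeps
  \<open>p\<close>.\<close>

lemma cb_derivative_singleton_shrink:
  fixes K U :: "'a::euclidean_space set"
  assumes r: "Well_order r" and K: "compact K" "cb_derivative r K = {p}"
    and U: "open U" "p \<in> U"
  shows "\<exists>L. compact L \<and> L \<subseteq> U \<and> cb_derivative r L = {p}"
proof -
  obtain e where e: "e > 0" "cball p e \<subseteq> U"
    using U open_contains_cball by blast
  have "closed K" "closed (K \<inter> cball p e)"
    using K(1) by (auto intro: compact_imp_closed)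
  then have "cb_derivative r (K \<inter> cball p e) \<subseteq> {p}"
    and "{p} \<inter> ball p e \<subseteq> cb_derivative r (K \<inter> cball p e)"
    using cb_derivative_mono[OF r, of "K \<inter> cball p e" K]
      cb_derivative_local[OF r _ _ open_ball, of K "K \<inter> cball p e" p e] ball_subset_cball[of p e] K(2)
    by blast+
  then have "cb_derivative r (K \<inter> cball p e) = {p}" using e by auto
  moreover have "compact (K \<inter> cball p e)" using K(1) by auto
  ultimately show ?thesis using e by blast
qed

section \<open>Compact unions, recurrent and cofinal sequences, disjoint compact sets\<close>

text \<open>The union is the intersection of the compact sets \<open>T N\<close>: a closed
  neighbourhood of \<open>F\<close> of radius \<open>1 / Suc N\<close> together with the finitely
  many \<open>K n\<close> with \<open>n \<in> S\<close> below \<open>N\<close>. The index set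
  \<open>S\<close> is free so that a single \<open>K n\<close> can be left out later.\<close>

lemma compact_Un_converging:
  fixes F :: "'a::euclidean_space set"
  assumes F: "compact F" "F \<noteq> {}" and K: "\<And>n. compact (K n)"
    and near: "\<And>n x. x \<in> K n \<Longrightarrow> infdist x F \<le> 1 / Suc n"
  shows "compact (F \<union> (\<Union>n\<in>S. K n))"
proof -
  define T where "T N = {x. infdist x F \<le> 1 / Suc N} \<union> (\<Union>n\<in>S \<inter> {..<N}. K n)" for N
  have "compact (T N)" for N
    unfolding T_def using F K by (intro compact_Un compact_UN compact_infdist_le) auto
  moreover have "F \<union> (\<Union>n\<in>S. K n) = (\<Inter>N. T N)"
  proof (intro set_eqI iffI)
    fix x assume x: "x \<in> F \<union> (\<Union>n\<in>S. K n)"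
    show "x \<in> (\<Inter>N. T N)"
    proof
      fix N
      show "x \<in> T N"
      proof (cases "x \<in> F")
        case True
        then show ?thesis by (simp add: T_def)
      next
        case False
        then obtain n where n: "n \<in> S" "x \<in> K n" using x by blast
        show ?thesis
        proof (cases "n < N")
          case True
          then show ?thesis using n by (auto simp: T_def)
        next
          case False
          then have "1 / real (Suc n) \<le> 1 / Suc N" by (simp add: frac_le)
          then show ?thesis using near[OF n(2)] by (simp add: T_def)
        qed
      qed
    qed
  next
    fix x assume x: "x \<in> (\<Inter>N. T N)"
    show "x \<in> F \<union> (\<Union>n\<in>S. K n)"
    proof (rule ccontr)
      assume not: "x \<notin> F \<union> (\<Union>n\<in>S. K n)"
      then have le: "infdist x F \<le> 1 / Suc N" for N
        using x by (auto simp: T_def)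
      have "0 < infdist x F"
        using not F infdist_pos_not_in_closed[of F x] compact_imp_closed by auto
      then obtain N where "1 / real (Suc N) < infdist x F"
        using nat_approx_posE by blast
      then show False using le[of N] by simp
    qed
  qed
  ultimately show ?thesis using compact_Inter[of "range T"] by auto
qed

text \<open>Decoding \<open>n\<close> as a pair and ignoring the second component repeats each point
  of a countable dense set infinitely often, so every tail stays dense.\<close>

lemma recurrent_dense_sequence:
  fixes S :: "'a::euclidean_space set"
  assumes "S \<noteq> {}"
  obtains d :: "nat \<Rightarrow> 'a" where "range d \<subseteq> S"
    and "\<And>x e N. x \<in> S \<Longrightarrow> e > 0 \<Longrightarrow> \<exists>n\<ge>N. dist (d n) x < e"
proof -
  obtain D where D: "countable D" "D \<subseteq> S" "S \<subseteq> closure D"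
    using separable[of S] by blast
  then have "D \<noteq> {}" using assms by auto
  define d where "d n = from_nat_into D (fst (prod_decode n))" for n
  show thesis
  proof
    show "range d \<subseteq> S"
      using from_nat_into[OF \<open>D \<noteq> {}\<close>] D by (auto simp: d_def)
    fix x and e :: real and N :: nat assume "x \<in> S" "e > 0"
    then obtain y where y: "y \<in> D" "dist y x < e"
      using D(3) by (meson closure_approachable subsetD)
    then obtain i where "from_nat_into D i = y"
      using from_nat_into_surj[OF D(1)] by blast
    \<comment> \<open>Encoding with second component \<open>N\<close> yields an index that is at
      least \<open>N\<close>.\<close>
    then have "d (prod_encode (i, N)) = y" by (simp add: d_def)
    then show "\<exists>n\<ge>N. dist (d n) x < e"
      using y le_prod_encode_2 by metis
  qed
qed

text \<open>\<open>g n\<close> is an upper bound of the first \<open>n + 1\<close> terms of an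
  enumeration of the field. If there is a greatest element, \<open>g\<close> eventually equals it,
  so successors and limits are treated alike.\<close>

lemma countable_Well_order_cofinal:
  assumes r: "Well_order r" and "countable (Field r)" "Field r \<noteq> {}"
  obtains g :: "nat \<Rightarrow> 'b" where "range g \<subseteq> Field r"
    and "\<And>x. x \<in> Field r \<Longrightarrow> \<exists>N. \<forall>n\<ge>N. (x, g n) \<in> r"
proof -
  obtain e :: "nat \<Rightarrow> 'b" where e: "range e = Field r"
    using uncountable_def assms by blast
  have "\<exists>y\<in>Field r. \<forall>i\<le>n. (e i, y) \<in> r" for n
  proof (induction n)
    case 0
    then show ?case
      using e Well_order_le_total[OF r, of "e 0" "e 0"] by (auto simp: underS_def)
  next
    case (Suc n)
    then obtain y where y: "y \<in> Field r" "\<forall>i\<le>n. (e i, y) \<in> r" by blast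
    have es: "e (Suc n) \<in> Field r" using e by blast
    show ?case
    proof (cases "(e (Suc n), y) \<in> r")
      case True
      then show ?thesis using y by (auto simp: le_Suc_eq)
    next
      case False
      then have "(y, e (Suc n)) \<in> r"
        using Well_order_le_total[OF r es y(1)] by (auto simp: underS_def)
      moreover have "(e (Suc n), e (Suc n)) \<in> r"
        using Well_order_le_total[OF r es es] by (auto simp: underS_def)
      ultimately show ?thesis
        using y es wo_rel.TRANS[of r] r by (auto simp: wo_rel_def le_Suc_eq dest: transD)
    qed
  qed
  then obtain g where g: "\<And>n. g n \<in> Field r" "\<And>n i. i \<le> n \<Longrightarrow> (e i, g n) \<in> r"
    by metis
  show thesis
  proof
    show "range g \<subseteq> Field r" using g by blast
    fix x assume "x \<in> Field r"
    then obtain i where "x = e i" using e by blast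
    then show "\<exists>N. \<forall>n\<ge>N. (x, g n) \<in> r" using g(2) by blast
  qed
qed

text \<open>The sets are chosen recursively, each avoiding \<open>F\<close> and its predecessors;
  \<open>Q\<close> stands for the later condition on derivatives.\<close>

lemma disjoint_compacts_near_frontier:
  fixes F :: "'a::euclidean_space set" and Q :: "nat \<Rightarrow> 'a set \<Rightarrow> bool"
  assumes F: "closed F" and d: "\<And>n. d n \<in> frontier F"
    and Q: "\<And>n p U. open U \<Longrightarrow> p \<in> U \<Longrightarrow> \<exists>L. compact L \<and> L \<subseteq> U \<and> Q n L"
  obtains K where "\<And>n. compact (K n)" "\<And>n. K n \<inter> F = {}" "\<And>n. K n \<subseteq> ball (d n) (1 / Suc n)"
    "\<And>m n. m \<noteq> n \<Longrightarrow> K m \<inter> K n = {}" "\<And>n. Q n (K n)"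
proof -
  define P where "P f n L \<longleftrightarrow> compact L \<and> L \<inter> F = {} \<and> L \<subseteq> ball (d n) (1 / Suc n)
      \<and> (\<forall>m<n. f m \<inter> L = {}) \<and> Q n L" for f :: "nat \<Rightarrow> 'a set" and n L
  have "\<exists>f. \<forall>n. P f n (f n)"
  proof (rule dependent_wellorder_choice)
    fix n and f :: "nat \<Rightarrow> 'a set"
    assume f: "\<And>m. m < n \<Longrightarrow> P f m (f m)"
    define V where "V = ball (d n) (1 / Suc n) - (\<Union>m<n. f m)"
    have dn: "d n \<in> F" "d n \<in> closure (- F)"
      using d[of n] F by (auto simp: frontier_closures)
    have "closed (\<Union>m<n. f m)"
      using f by (intro closed_UN) (auto simp: P_def intro: compact_imp_closed)
    then have "open V" by (auto simp: V_def)
    \<comment> \<open>The earlier sets miss \<open>F\<close>, so \<open>V\<close> is a neighbourhood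
      of \<open>d n\<close>; since \<open>d n\<close> is a frontier point, \<open>V\<close> also has
      a point outside \<open>F\<close>.\<close>
    moreover have "d n \<in> V" using dn(1) f by (auto simp: V_def P_def)
    ultimately obtain p where "p \<in> V - F"
      using dn(2) by (auto simp: closure_iff_nhds_not_empty)
    then obtain L where "compact L" "L \<subseteq> V - F" "Q n L"
      using Q[of "V - F" p n] \<open>open V\<close> F by auto
    then show "\<exists>L. P f n L" by (intro exI[of _ L]) (auto simp: P_def V_def)
  qed (auto simp: P_def)
  then obtain f where f: "\<And>n. P f n (f n)" by blast
  have "f m \<inter> f n = {}" if "m \<noteq> n" for m n
    using f[of m] f[of n] that by (cases m n rule: linorder_cases) (auto simp: P_def)
  then show thesis using that[of f] f by (auto simp: P_def)
qed

section \<open>The transfinite induction\<close>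

text \<open>The induction hypothesis is applied only to singletons \<open>{p}\<close>, at the
  segments \<open>init_seg r (g n)\<close>.\<close>

theorem ex_compact_cb_derivative_eq:
  fixes \<alpha> :: "'b rel" and F :: "'a::euclidean_space set"
  assumes "Well_order \<alpha>" "countable (Field \<alpha>)" "compact F"
  shows "\<exists>K. compact K \<and> cb_derivative \<alpha> K = F"
  using assms
proof (induction \<alpha> arbitrary: F rule: wf_induct_rule[OF wf_ordLess])
  case (1 r)
  note r = 1(2) and F = 1(4)
  define D where "D x A = cb_derivative (init_seg r x) A" for x and A :: "'a set"
  have seg: "Well_order (init_seg r x)" for x using Well_order_init_seg[OF r] .
  consider "Field r = {}" | "F = {}" | "Field r \<noteq> {}" "F \<noteq> {}" by blast
  then show ?case
  proof cases
    case 1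
    then show ?thesis using r F cb_derivative_zero by blast
  next
    case 2
    then show ?thesis
      using cb_derivative_subset[OF r closed_empty] by (intro exI[of _ "{}"]) auto
  next
    case 3
    have cF: "closed F" using F compact_imp_closed by blast
    obtain g :: "nat \<Rightarrow> 'b" where g: "range g \<subseteq> Field r"
      and g_cof: "\<And>x. x \<in> Field r \<Longrightarrow> \<exists>N. \<forall>n\<ge>N. (x, g n) \<in> r"
      using countable_Well_order_cofinal[OF r \<open>countable (Field r)\<close> 3(1)] by blast
    have gF: "g n \<in> Field r" for n using g by auto
    \<comment> \<open>A Euclidean space is connected and not compact, so the nonempty compact
      \<open>F\<close> has a frontier point.\<close>
    have "F \<noteq> UNIV" using F by auto
    then have "frontier F \<noteq> {}" using 3(2) by (simp add: frontier_eq_empty)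
    then obtain d :: "nat \<Rightarrow> 'a" where d: "range d \<subseteq> frontier F"
      and d_rec: "\<And>x e N. x \<in> frontier F \<Longrightarrow> e > 0 \<Longrightarrow> \<exists>n\<ge>N. dist (d n) x < e"
      using recurrent_dense_sequence by blast
    have small: "\<exists>L. compact L \<and> L \<subseteq> U \<and> (\<exists>p. D (g n) L = {p})" if "open U" "p \<in> U" for n p U
    proof -
      have "countable (Field (init_seg r (g n)))"
        unfolding Field_init_seg[OF r]
        by (rule countable_subset[OF _ \<open>countable (Field r)\<close>]) (auto intro: underS_Field)
      then obtain K where K: "compact K" "cb_derivative (init_seg r (g n)) K = {p}"
        using 1(1)[OF init_seg_ordLess[OF r gF[of n]] seg, of "{p}"] by auto
      then show ?thesis
        using cb_derivative_singleton_shrink[OF seg K that] by (fold D_def) iprover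
    qed
    have d_frontier: "d n \<in> frontier F" for n using d by auto
    obtain K where K: "\<And>n. compact (K n)" "\<And>n. K n \<inter> F = {}"
        "\<And>n. K n \<subseteq> ball (d n) (1 / Suc n)" "\<And>m n. m \<noteq> n \<Longrightarrow> K m \<inter> K n = {}"
        "\<And>n. \<exists>p. D (g n) (K n) = {p}"
      by (rule disjoint_compacts_near_frontier[where d = d and Q = "\<lambda>n L. \<exists>p. D (g n) L = {p}",
            OF cF d_frontier]) (assumption | rule small that)+
    have dF: "d n \<in> F" for n using d_frontier cF frontier_subset_closed by blast
    have near: "infdist x F \<le> 1 / Suc n" if "x \<in> K n" for n x
    proof -
      have "infdist x F \<le> dist x (d n)" using dF by (rule infdist_le)
      also have "\<dots> < 1 / Suc n" using that K(3)[of n] by (auto simp: dist_commute)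
      finally show ?thesis by simp
    qed
    note compactK = compact_Un_converging[OF F 3(2) K(1) near]
    define E where "E = F \<union> (\<Union>n. K n)"
    have "compact E" unfolding E_def by (rule compactK)
    then have cE: "closed E" by (rule compact_imp_closed)
    have cK: "closed (K n)" for n using K(1) by (rule compact_imp_closed)

    \<comment> \<open>\<open>F\<close> with all other \<open>K m\<close> is compact, so
      \<open>U\<close> isolates \<open>K n\<close> within \<open>E\<close> and locality applies. The
      derivative of \<open>K n\<close> along \<open>r\<close> lies in the derived set of a
      singleton, which is empty.\<close>
    have "cb_derivative r E \<inter> K n = {}" for n
    proof -
      define U where "U = - (F \<union> (\<Union>m\<in>-{n}. K m))"
      have "open U" unfolding U_def by (intro open_Compl compact_imp_closed compactK)
      moreover have "K n \<subseteq> U" using K(2,4) by (fastforce simp: U_def)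
      moreover have "E \<inter> U \<subseteq> K n" by (auto simp: U_def E_def)
      ultimately have "cb_derivative r E \<inter> K n \<subseteq> cb_derivative r (K n)"
        using cb_derivative_local[OF r cE cK] by blast
      also have "\<dots> \<subseteq> derived_set (D (g n) (K n))"
        using gF[of n] unfolding D_def cb_derivative_closed_eq[OF r cK] by blast
      also have "\<dots> = {}"
        using K(5)[of n] by (auto simp: derived_set_def islimpt_finite)
      finally show ?thesis by blast
    qed
    then have sub: "cb_derivative r E \<subseteq> F"
      using cb_derivative_subset[OF r cE] unfolding E_def by blast

    \<comment> \<open>For large \<open>n\<close> the index \<open>g n\<close> is at least
      \<open>x\<close>, so the singleton \<open>D (g n) (K n)\<close> survives inside
      \<open>D x E\<close>.\<close>
    have meets: "\<exists>N. \<forall>n\<ge>N. D x E \<inter> K n \<noteq> {}" if x: "x \<in> Field r" for x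
    proof -
      obtain N where N: "\<And>n. n \<ge> N \<Longrightarrow> (x, g n) \<in> r" using g_cof[OF x] by blast
      have "D x E \<inter> K n \<noteq> {}" if "n \<ge> N" for n
      proof -
        have "D (g n) (K n) \<subseteq> D x (K n)"
          unfolding D_def by (rule cb_derivative_init_seg_antimono[OF r cK N[OF that]])
        moreover have "D x (K n) \<subseteq> D x E"
          unfolding D_def by (rule cb_derivative_mono[OF seg cK cE]) (auto simp: E_def)
        moreover have "D x (K n) \<subseteq> K n"
          unfolding D_def by (rule cb_derivative_subset[OF seg cK])
        ultimately show ?thesis using K(5)[of n] by blast
      qed
      then show ?thesis by blast
    qed
    \<comment> \<open>Interior points of \<open>F\<close> are limit points of \<open>F\<close>
      itself. Frontier points are approached through sets \<open>K n\<close> with large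
      \<open>n\<close>, whose points differ from \<open>p\<close> because \<open>K n\<close> misses
      \<open>F\<close>.\<close>
    have limpt: "p islimpt T"
      if p: "p \<in> F" and T: "F \<subseteq> T" "\<forall>n\<ge>N. T \<inter> K n \<noteq> {}" for p T N
    proof (cases "p \<in> interior F")
      case True
      then show ?thesis
        using T(1) interior_limit_point islimpt_subset by blast
    next
      case False
      then have pf: "p \<in> frontier F" using p cF by (simp add: frontier_def)
      show ?thesis unfolding islimpt_approachable
      proof (intro allI impI)
        fix e :: real assume e: "e > 0"
        obtain M where M: "1 / real (Suc M) < e / 2"
          using nat_approx_posE[of "e / 2"] e by auto
        obtain n where n: "n \<ge> max M N" "dist (d n) p < e / 2"
          using d_rec[OF pf, of "e / 2" "max M N"] e by auto
        obtain t where t: "t \<in> T" "t \<in> K n" using T(2) n(1) by auto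
        have "1 / real (Suc n) \<le> 1 / Suc M" using n(1) by (simp add: frac_le)
        then have "dist (d n) t < e / 2" using t(2) K(3)[of n] M by fastforce
        then have "dist t p < e"
          using n(2) dist_triangle2[of t p "d n"] dist_triangle[of t p "d n"]
          by (simp add: dist_commute)
        moreover have "t \<noteq> p" using t(2) p K(2) by blast
        ultimately show "\<exists>x'\<in>T. x' \<noteq> p \<and> dist x' p < e" using t(1) by blast
      qed
    qed
    \<comment> \<open>The claim concerns the derived set of \<open>D x E\<close> to fit the formula:
      the hypotheses for all \<open>y\<close> below \<open>x\<close> give
      \<open>F \<subseteq> D x E\<close>, and \<open>meets\<close> with \<open>limpt\<close> then
      gains one more derivative.\<close>
    have "x \<in> Field r \<longrightarrow> F \<subseteq> derived_set (D x E)" for x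
    proof (induction x rule: wf_induct_rule[OF wo_rel.WF[of r]])
      case 1
      then show ?case using r by (simp add: wo_rel_def)
    next
      case (2 x)
      show ?case
      proof
        assume x: "x \<in> Field r"
        have "F \<subseteq> derived_set (D y E)" if "y \<in> underS r x" for y
          using 2 that by (auto simp: underS_def intro: FieldI1)
        then have "F \<subseteq> D x E"
          unfolding D_def cb_derivative_closed_eq[OF seg cE, of x]
          by (auto simp: E_def Field_init_seg[OF r] init_seg_init_seg[OF r])
        then show "F \<subseteq> derived_set (D x E)"
          using meets[OF x] limpt by (auto simp: derived_set_def)
      qed
    qed
    then have "F \<subseteq> cb_derivative r E"
      unfolding cb_derivative_closed_eq[OF r cE] by (auto simp: D_def E_def)
    then show ?thesis using sub \<open>compact E\<close> by blast
  qed
qed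

theorem theorem3p5:
  fixes \<alpha> :: "'b rel" and F :: "real set"
  assumes "Well_order \<alpha>" and "countable (Field \<alpha>)"
    and "compact F"
  shows "\<exists>K :: real set. compact K \<and> cb_derivative \<alpha> K = F"
  using assms by (rule ex_compact_cb_derivative_eq)

end
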